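(* Let $R$ be a commutative ring with nonzero identity, $M$ a prime $R$-module, and $N\leq M$ a submodule. Then the following statements are equivalent: (1) $N$ is essential in $M$; (2) $N$ is $u$-$\mathfrak{p}$-essential in $M$ for every prime ideal $\mathfrak{p}$ of $R$; (3) $N$ is $u$-$\mathfrak{m}$-essential in $M$ for every maximal ideal $\mathfrak{m}$ of $R$.
   Context: All modules are unitary. An $R$-module $M$ is prime if $\mathrm{Ann}_R(K)=\mathrm{Ann}_R(M)$ for every nonzero submodule $K$ of $M$. For a multiplicative subset $S$ of $R$ (that is, $1\in S$, $0\notin S$, $S$ closed under products), an $R$-module $X$ is $u$-$S$-torsion if there exists $s\in S$ with $sX=0$, and a submodule $N$ of $M$ is $u$-$S$-essential in $M$ if for every submodule $L$ of $M$, $N\cap L$ being $u$-$S$-torsion implies that $L$ is $u$-$S$-torsion. For a prime ideal $\mathfrak{p}$ of $R$, $N$ is $u$-$\mathfrak{p}$-essential in $M$ if $N$ is $u$-$(R\setminus\mathfrak{p})$-essential in $M$. A submodule $N$ of $M$ is essential in $M$ if for every submodule $L$ of $M$, $N\cap L=0$ implies $L=0$. *)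

theory Defs
  imports "HOL-Algebra.Module" "HOL-Algebra.Ideal"
begin

text \<open>
  Submodules \<open>K\<close> of \<open>M\<close> are sets; where such a set has to be regarded as a module in its own
  right, it is passed as \<open>M\<lparr>carrier := K\<rparr>\<close> (cf. \<open>submodule.submodule_is_module\<close>).
\<close>

definition annihilator :: "('a, 'r) ring_scheme \<Rightarrow> ('a, 'b, 'm) module_scheme \<Rightarrow> 'a set"
  where "annihilator R X =
    {r \<in> carrier R. \<forall>x \<in> carrier X. r \<odot>\<^bsub>X\<^esub> x = \<zero>\<^bsub>X\<^esub>}"

text \<open>The zero module is not excluded; it is prime vacuously.\<close>

locale prime_module = Module.module R M for R (structure) and M (structure) +
  assumes annihilator_eq:
    "\<lbrakk>submodule K R M; K \<noteq> {\<zero>\<^bsub>M\<^esub>}\<rbrakk>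
      \<Longrightarrow> annihilator R (M\<lparr>carrier := K\<rparr>) = annihilator R M"

locale multiplicative_subset = submonoid S R for S and R (structure) +
  assumes zero_notin: "\<zero> \<notin> S"

text \<open>
  The next two notions are meant for a multiplicative subset \<open>S\<close> of \<open>R\<close>; below they are applied
  to complements of prime ideals, which are multiplicative by \<open>multiplicative_subset_compl\<close>.
\<close>

definition u_torsion :: "('a, 'r) ring_scheme \<Rightarrow> 'a set \<Rightarrow> ('a, 'b, 'm) module_scheme \<Rightarrow> bool"
  where "u_torsion R S X \<longleftrightarrow> (\<exists>s \<in> S. \<forall>x \<in> carrier X. s \<odot>\<^bsub>X\<^esub> x = \<zero>\<^bsub>X\<^esub>)"

definition u_essential ::
    "('a, 'r) ring_scheme \<Rightarrow> 'a set \<Rightarrow> ('a, 'b, 'm) module_scheme \<Rightarrow> 'b set \<Rightarrow> bool"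
  where "u_essential R S M N \<longleftrightarrow>
    (\<forall>L. submodule L R M \<longrightarrow>
      u_torsion R S (M\<lparr>carrier := N \<inter> L\<rparr>) \<longrightarrow> u_torsion R S (M\<lparr>carrier := L\<rparr>))"

definition u_prime_essential ::
    "('a, 'r) ring_scheme \<Rightarrow> 'a set \<Rightarrow> ('a, 'b, 'm) module_scheme \<Rightarrow> 'b set \<Rightarrow> bool"
  where "u_prime_essential R P M N \<longleftrightarrow> u_essential R (carrier R - P) M N"

definition essential ::
    "('a, 'r) ring_scheme \<Rightarrow> ('a, 'b, 'm) module_scheme \<Rightarrow> 'b set \<Rightarrow> bool"
  where "essential R M N \<longleftrightarrow>
    (\<forall>L. submodule L R M \<longrightarrow> N \<inter> L = {\<zero>\<^bsub>M\<^esub>} \<longrightarrow> L = {\<zero>\<^bsub>M\<^esub>})"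

lemma multiplicative_subset_compl:
  assumes "primeideal P R"
  shows "multiplicative_subset (carrier R - P) R"
proof -
  interpret primeideal P R by fact
  show ?thesis
  proof
    show "\<one>\<^bsub>R\<^esub> \<in> carrier R - P"
      using I_notcarr one_imp_carrier by auto
  qed (use I_prime in auto)
qed

text \<open>A maximal ideal is prime, so \<open>u_prime_essential\<close> is also meaningful for maximal ideals.\<close>

lemma multiplicative_subset_compl_maximal:
  assumes "cring R" "maximalideal P R"
  shows "multiplicative_subset (carrier R - P) R"
  using cring.maximalideal_prime[OF assms] multiplicative_subset_compl by blast

end

theory Submission
  imports Defs "HOL-Algebra.Ring_Divisibility"
begin

text \<open>
  In a prime module every nonzero submodule has the annihilator of \<open>M\<close>. Hence if \<open>N \<inter> L\<close> is
  nonzero and killed by \<open>s\<close>, then \<open>s\<close> kills \<open>M\<close>, and so \<open>L\<close>; this turns essential into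
  \<open>u\<close>-\<open>\<pp>\<close>-essential. Conversely, if \<open>N \<inter> L = 0\<close>, then for each maximal ideal \<open>\<mm>\<close>
  the annihilator of \<open>L\<close> contains an element outside \<open>\<mm>\<close>, so it is an ideal contained in no
  maximal ideal and therefore contains \<open>1\<close>.
\<close>

text \<open>Zorn's lemma applies to the ideals above \<open>I\<close> that avoid
  \<open>\<one>\<close>, since the union of a nonempty chain of them still avoids
  \<open>\<one>\<close>. A maximal member is a maximal ideal: any strictly larger ideal contains
  \<open>\<one>\<close> and so is the whole ring.\<close>

lemma (in ring) exists_maximalideal:
  assumes "ideal I R" "\<one> \<notin> I"
  obtains J where "maximalideal J R" "I \<subseteq> J"
proof -
  let ?A = "{J. ideal J R \<and> I \<subseteq> J \<and> \<one> \<notin> J}"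
  have "\<exists>J\<in>?A. \<forall>K\<in>?A. J \<subseteq> K \<longrightarrow> K = J"
  proof (rule subset_Zorn_nonempty)
    show "?A \<noteq> {}" using assms by blast
  next
    fix C assume C: "C \<noteq> {}" "subset.chain ?A C"
    then have "subset.chain {J. ideal J R} C"
      unfolding pred_on.chain_def by blast
    then have "ideal (\<Union>C) R"
      using chain_Union_is_ideal[of C] C(1) by simp
    then show "\<Union>C \<in> ?A"
      using C unfolding pred_on.chain_def by blast
  qed
  then obtain J where "J \<in> ?A" and max: "\<forall>K\<in>?A. J \<subseteq> K \<longrightarrow> K = J" ..
  then have J: "ideal J R" "I \<subseteq> J" "\<one> \<notin> J" by simp_all
  have "maximalideal J R"
  proof (rule maximalidealI)
    show "carrier R \<noteq> J" using J(3) by auto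
    show "K = J \<or> K = carrier R" if "ideal K R" "J \<subseteq> K" "K \<subseteq> carrier R" for K
    proof (cases "\<one> \<in> K")
      case True
      then show ?thesis using ideal.one_imp_carrier[OF that(1)] by simp
    next
      case False
      then show ?thesis using that J(2) max by simp
    qed
  qed (rule J(1))
  with J(2) that show thesis by blast
qed

context Module.module
begin

lemma ideal_annihilator:
  assumes "L \<subseteq> carrier M"
  shows "ideal (annihilator R (M\<lparr>carrier := L\<rparr>)) R"
proof (rule idealI)
  have L: "x \<in> carrier M" if "x \<in> L" for x using assms that by blast
  show "subgroup (annihilator R (M\<lparr>carrier := L\<rparr>)) (add_monoid R)"
  proof (rule R.add.subgroupI)
    have "\<zero> \<in> annihilator R (M\<lparr>carrier := L\<rparr>)"
      by (simp add: annihilator_def L)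
    then show "annihilator R (M\<lparr>carrier := L\<rparr>) \<noteq> {}" by blast
  qed (auto simp: annihilator_def L smult_l_distr smult_l_minus)
  show "x \<otimes> a \<in> annihilator R (M\<lparr>carrier := L\<rparr>)"
    if "a \<in> annihilator R (M\<lparr>carrier := L\<rparr>)" "x \<in> carrier R" for a x
    using that by (auto simp: annihilator_def L smult_assoc1)
  then show "a \<otimes> x \<in> annihilator R (M\<lparr>carrier := L\<rparr>)"
    if "a \<in> annihilator R (M\<lparr>carrier := L\<rparr>)" "x \<in> carrier R" for a x
    using that by (metis (no_types, lifting) annihilator_def mem_Collect_eq m_comm)
qed (rule R.ring_axioms)

lemma submodule_Int:
  assumes "submodule N R M" "submodule L R M"
  shows "submodule (N \<inter> L) R M"
  using submoduleE[OF assms(1)] submoduleE[OF assms(2)]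
    submodule.axioms(1)[OF assms(1)] submodule.axioms(1)[OF assms(2)]
  by (intro submoduleI) (auto dest: subgroup.one_closed)

text \<open>This reduces torsion to annihilators: an inclusion of annihilators carries torsion from
  one submodule to another, and an annihilator inside \<open>J\<close> excludes torsion for the
  complement of \<open>J\<close>.\<close>

lemma u_torsion_iff:
  assumes "S \<subseteq> carrier R"
  shows "u_torsion R S (M\<lparr>carrier := L\<rparr>) \<longleftrightarrow> S \<inter> annihilator R (M\<lparr>carrier := L\<rparr>) \<noteq> {}"
  using assms unfolding u_torsion_def annihilator_def by auto

lemma u_torsion_zero:
  assumes "S \<subseteq> carrier R" "S \<noteq> {}"
  shows "u_torsion R S (M\<lparr>carrier := {\<zero>\<^bsub>M\<^esub>}\<rparr>)"
  using assms unfolding u_torsion_def by (auto simp: subset_iff)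

lemma essential_if_u_maximal_essential:
  assumes "\<And>\<mm>. maximalideal \<mm> R \<Longrightarrow> u_prime_essential R \<mm> M N"
  shows "essential R M N"
  unfolding essential_def
proof (intro allI impI)
  fix L assume L: "submodule L R M" and NL: "N \<inter> L = {\<zero>\<^bsub>M\<^esub>}"
  let ?I = "annihilator R (M\<lparr>carrier := L\<rparr>)"
  have sub: "L \<subseteq> carrier M" using L by (rule submoduleE)
  have "\<one> \<in> ?I"
  proof (rule ccontr)
    assume "\<one> \<notin> ?I"
    then obtain J where J: "maximalideal J R" "?I \<subseteq> J"
      using R.exists_maximalideal ideal_annihilator[OF sub] by blast
    interpret multiplicative_subset "carrier R - J" R
      using multiplicative_subset_compl_maximal R.is_cring J(1) .
    \<comment> \<open>The complement of \<open>J\<close> contains \<open>\<one>\<close>, so some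
      element of it kills the zero submodule.\<close>
    have "u_torsion R (carrier R - J) (M\<lparr>carrier := N \<inter> L\<rparr>)"
      unfolding NL using one_closed by (intro u_torsion_zero) auto
    then have "u_torsion R (carrier R - J) (M\<lparr>carrier := L\<rparr>)"
      using assms[OF J(1)] L unfolding u_prime_essential_def u_essential_def by blast
    \<comment> \<open>Torsion yields an element outside \<open>J\<close> that kills
      \<open>L\<close>, whereas \<open>?I\<close> lies in \<open>J\<close>.\<close>
    then show False
      using J(2) by (auto simp: u_torsion_iff)
  qed
  \<comment> \<open>Since \<open>\<one>\<close> acts as the identity, every element of
    \<open>L\<close> equals its product with \<open>\<one>\<close>, which is zero.\<close>
  then have "L \<subseteq> {\<zero>\<^bsub>M\<^esub>}"
    using sub unfolding annihilator_def by (auto simp: subset_iff)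
  then show "L = {\<zero>\<^bsub>M\<^esub>}"
    using NL by blast
qed

end

lemma (in prime_module) u_essential_if_essential:
  assumes N: "submodule N R M" and ess: "essential R M N" and S: "S \<subseteq> carrier R"
  shows "u_essential R S M N"
  unfolding u_essential_def
proof (intro allI impI)
  fix L assume L: "submodule L R M" and tors: "u_torsion R S (M\<lparr>carrier := N \<inter> L\<rparr>)"
  show "u_torsion R S (M\<lparr>carrier := L\<rparr>)"
  proof (cases "N \<inter> L = {\<zero>\<^bsub>M\<^esub>}")
    case True
    then have "L = {\<zero>\<^bsub>M\<^esub>}" using ess L unfolding essential_def by blast
    \<comment> \<open>Here \<open>L\<close> coincides with its intersection with \<open>N\<close>,
      so \<open>tors\<close> is already the goal and supplies the element of
      \<open>S\<close>.\<close>
    with True tors show ?thesis by simp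
  next
    case False
    \<comment> \<open>Primeness enters here: whatever kills this nonzero submodule kills all of
      \<open>M\<close>.\<close>
    then have "annihilator R (M\<lparr>carrier := N \<inter> L\<rparr>) = annihilator R M"
      by (intro annihilator_eq submodule_Int N L)
    also have "\<dots> \<subseteq> annihilator R (M\<lparr>carrier := L\<rparr>)"
      using submoduleE(1)[OF L] unfolding annihilator_def by auto
    finally show ?thesis
      using tors S by (auto simp: u_torsion_iff)
  qed
qed

theorem proposition2p15:
  fixes R :: "('a, 'r) ring_scheme" and M :: "('a, 'b, 'm) module_scheme" and N :: "'b set"
  assumes "cring R"
    and "\<one>\<^bsub>R\<^esub> \<noteq> \<zero>\<^bsub>R\<^esub>"
    and "prime_module R M"
    and "submodule N R M"
  shows "(essential R M N \<longleftrightarrow>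
            (\<forall>\<pp>. primeideal \<pp> R \<longrightarrow> u_prime_essential R \<pp> M N)) \<and>
         ((\<forall>\<pp>. primeideal \<pp> R \<longrightarrow> u_prime_essential R \<pp> M N) \<longleftrightarrow>
            (\<forall>\<mm>. maximalideal \<mm> R \<longrightarrow> u_prime_essential R \<mm> M N))"
proof -
  interpret prime_module R M by fact
  have "u_prime_essential R P M N" if "essential R M N" for P
    unfolding u_prime_essential_def using assms(4) that by (rule u_essential_if_essential) blast
  \<comment> \<open>This gives the passage from prime to maximal ideals;
    \<open>essential_if_u_maximal_essential\<close> then closes the cycle of implications.\<close>
  moreover have "primeideal \<mm> R" if "maximalideal \<mm> R" for \<mm>
    using that by (rule R.maximalideal_prime)
  ultimately show ?thesis
    using essential_if_u_maximal_essential by blast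
qed

end
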